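(* Let $p,q\ge 3$ be integers, let $G_{p,q}=\langle a,b,c\mid a^2=b^2=c^2=(ab)^q=(ac)^2=(bc)^p=1\rangle$ be the associated reflection group with fundamental triangle $F$, and let $S$ be a subgroup of $G_{p,q}$ of (finite) index $k$. Then: (1) $S$ induces a perfect $k$-colouring of the regular tiling $(q^p)$ if and only if $a,b\in S$. (2) $S$ induces a perfect $k$-colouring of the regular tiling $(p^q)$ if and only if $b,c\in S$. (3) $S$ induces a perfect $k$-colouring of the Laves tiling $[p.q.p.q]$ if and only if $a,c\in S$.
   Context: Let $p,q\ge 3$ be integers and let $\mathbb{X}$ be the sphere $\mathbb{S}^2$, the Euclidean plane $\mathbb{R}^2$ or the hyperbolic plane $\mathbb{H}^2$ according to whether $\frac1p+\frac1q$ is $>$, $=$ or $<\frac12$. Let $F=F_{p,q}\subset\mathbb{X}$ be a closed geodesic triangle with angles $\frac{\pi}{2},\frac{\pi}{p},\frac{\pi}{q}$. Let $a$, $b$, $c$ denote the reflections in the lines spanned by the edges of $F$ opposite to the angles $\frac{\pi}{p}$, $\frac{\pi}{2}$, $\frac{\pi}{q}$, respectively. They generate the Coxeter group $G_{p,q}=\langle a,b,c\mid a^2=b^2=c^2=(ab)^q=(ac)^2=(bc)^p=1\rangle$ of isometries of $\mathbb{X}$, for which $F$ is a fundamental domain. The triangles $fF$ ($f\in G_{p,q}$) form a tiling $T_{p,q}$ of $\mathbb{X}$, and $f\mapsto fF$ is a bijection from $G_{p,q}$ to the tiles of $T_{p,q}$. Tilings. $(p^q)$ is the regular tiling of $\mathbb{X}$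 by regular $p$-gons, $q$ of them meeting at each vertex. It is positioned so that its tiles are the images under $G_{p,q}$ of the $p$-gon $\bigcup_{h\in\langle b,c\rangle}hF$. $(q^p)$ is the dual regular tiling by regular $q$-gons, $p$ meeting at each vertex; its tiles are the images under $G_{p,q}$ of the $q$-gon $\bigcup_{h\in\langle a,b\rangle}hF$. $[p.q.p.q]$ is the Laves tiling obtained from $(p^q)$ by taking as edges the line segments joining the centre of each $p$-gon to each of its vertices; its tiles are congruent quadrilaterals, namely the images under $G_{p,q}$ of $\bigcup_{h\in\langle a,c\rangle}hF=F\cup aF\cup cF\cup acF$. (The same tiling is written $[q.p.q.p]$ if $p>q$.) $G_{p,q}$ is taken as the symmetry group of all these tilings. Colourings. A $k$-colouring of a tiling $X$ is a surjective map $c_X$ from the set of tiles of $X$ to $\{1,\dots,k\}$. It is perfect if for every $h\in G_{p,q}$ there is a permutation $\pi$ of $\{1,\dots,k\}$ with $c_X(hx)=\pi(c_X(x))$ for all tiles $x$. Induced colourings. A subgroup $S\subseteq G_{p,q}$ of index $k$, with left cosets $S_1=S,S_2,\dots,S_k$, defines a $k$-colouring of $T_{p,q}$ by giving the triangle $fF$ the colour $i$ if $f\in S_i$ (the left coset colouring). $S$ is said to induce a perfect $k$-colouring of one of the tilings $(p^q)$, $(q^p)$, $[p.q.p.q]$ if in this colouring, for each tile of that tiling, all triangles of $T_{p,q}$ contained in the tile have the same colour, and the resulting $k$-colouring of the tiles (each tile receiving the common colour of its triangles) is perfect. *)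

theory Defs
  imports
    "HOL-Analysis.Analysis"
    "HOL-Algebra.Bij"
    "HOL-Algebra.Left_Coset"
    "HOL-Algebra.Generated_Groups"
begin

section \<open>The sphere, the Euclidean plane and the hyperbolic plane\<close>

text \<open>
  The three geometries are realised as surfaces of constant curvature \<open>\<kappa> \<in> {1, 0, -1}\<close> in
  \<open>\<real>\<^sup>3\<close>: the unit sphere, the plane \<open>z = 1\<close>, and the upper sheet of the hyperboloid
  \<open>x\<^sup>2 + y\<^sup>2 - z\<^sup>2 = -1\<close>.  In each case the Riemannian metric is the restriction of the
  bilinear form \<open>form \<kappa>\<close> to the tangent planes, and the geodesic lines are the nonempty
  intersections with two-dimensional linear subspaces of \<open>\<real>\<^sup>3\<close>.
\<close>

definition form :: "real \<Rightarrow> real^3 \<Rightarrow> real^3 \<Rightarrow> real" where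
  "form \<kappa> u v = u$1 * v$1 + u$2 * v$2 + \<kappa> * (u$3 * v$3)"

definition surface :: "real \<Rightarrow> (real^3) set" where
  "surface \<kappa> =
     (if \<kappa> > 0 then sphere 0 1
      else if \<kappa> = 0 then {x. x$3 = 1}
      else {x. form (-1) x x = -1 \<and> x$3 > 0})"

definition geo_dist :: "real \<Rightarrow> real^3 \<Rightarrow> real^3 \<Rightarrow> real" where
  "geo_dist \<kappa> x y =
     (if \<kappa> > 0 then arccos (x \<bullet> y)
      else if \<kappa> = 0 then dist x y
      else arcosh (- form (-1) x y))"

definition curvature :: "nat \<Rightarrow> nat \<Rightarrow> real" where
  "curvature p q = sgn (1 / real p + 1 / real q - 1 / 2)"

definition geodesic_line :: "real \<Rightarrow> real^3 \<Rightarrow> real^3 \<Rightarrow> (real^3) set" where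
  "geodesic_line \<kappa> A B = surface \<kappa> \<inter> span {A, B}"

definition geodesic_triangle :: "real \<Rightarrow> real^3 \<Rightarrow> real^3 \<Rightarrow> real^3 \<Rightarrow> (real^3) set" where
  "geodesic_triangle \<kappa> A B C = surface \<kappa> \<inter>
     {\<alpha> *\<^sub>R A + \<beta> *\<^sub>R B + \<gamma> *\<^sub>R C | \<alpha> \<beta> \<gamma>. \<alpha> \<ge> 0 \<and> \<beta> \<ge> 0 \<and> \<gamma> \<ge> 0}"

text \<open>
  Three points of the surface span a nondegenerate triangle iff they do not lie on a common
  geodesic line, that is, iff they are linearly independent in \<open>\<real>\<^sup>3\<close>.
\<close>

definition triangle_vertices :: "real \<Rightarrow> real^3 \<Rightarrow> real^3 \<Rightarrow> real^3 \<Rightarrow> bool" where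
  "triangle_vertices \<kappa> A B C \<longleftrightarrow>
     {A, B, C} \<subseteq> surface \<kappa> \<and> distinct [A, B, C] \<and> independent {A, B, C}"

text \<open>
  The orthogonal projection (with respect to the form) of \<open>B - A\<close> to the tangent plane at \<open>A\<close>.
  It is a positive multiple of the initial velocity of the geodesic from \<open>A\<close> to \<open>B\<close>; for
  \<open>\<kappa> = 0\<close> it is \<open>B - A\<close>.
\<close>

definition direction :: "real \<Rightarrow> real^3 \<Rightarrow> real^3 \<Rightarrow> real^3" where
  "direction \<kappa> A B = (B - A) - (\<kappa> * form \<kappa> A (B - A)) *\<^sub>R A"

text \<open>The interior angle at \<open>A\<close> of the triangle with vertices \<open>A\<close>, \<open>B\<close>, \<open>C\<close>.\<close>

definition geo_angle :: "real \<Rightarrow> real^3 \<Rightarrow> real^3 \<Rightarrow> real^3 \<Rightarrow> real" where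
  "geo_angle \<kappa> A B C =
     (let u = direction \<kappa> A B; v = direction \<kappa> A C
      in arccos (form \<kappa> u v / (sqrt (form \<kappa> u u) * sqrt (form \<kappa> v v))))"


section \<open>Isometries and reflection groups\<close>

text \<open>
  As in \<^const>\<open>BijGroup\<close>, isometries are extensional functions, so that two of them are
  equal iff they agree on the surface.
\<close>

definition isometries :: "real \<Rightarrow> (real^3 \<Rightarrow> real^3) set" where
  "isometries \<kappa> = {f \<in> Bij (surface \<kappa>).
     \<forall>x \<in> surface \<kappa>. \<forall>y \<in> surface \<kappa>. geo_dist \<kappa> (f x) (f y) = geo_dist \<kappa> x y}"

definition is_reflection :: "real \<Rightarrow> (real^3) set \<Rightarrow> (real^3 \<Rightarrow> real^3) \<Rightarrow> bool" where
  "is_reflection \<kappa> L r \<longleftrightarrow> r \<in> isometries \<kappa> \<and> {x \<in> surface \<kappa>. r x = x} = L"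

definition reflection_group ::
    "real \<Rightarrow> (real^3 \<Rightarrow> real^3) set \<Rightarrow> (real^3 \<Rightarrow> real^3) monoid" where
  "reflection_group \<kappa> R =
     (BijGroup (surface \<kappa>)) \<lparr>carrier := generate (BijGroup (surface \<kappa>)) R\<rparr>"


section \<open>Tilings\<close>

text \<open>In this and the next section, \<open>G\<close> is a group of transformations and \<open>F\<close> is a set of points.\<close>

definition triangle_tiling :: "('a \<Rightarrow> 'a) monoid \<Rightarrow> 'a set \<Rightarrow> 'a set set" where
  "triangle_tiling G F = {f ` F | f. f \<in> carrier G}"

text \<open>
  The images under \<open>G\<close> of the union of all \<open>h F\<close> with \<open>h\<close> in the subgroup generated by \<open>R\<close>.
  For the reflections \<open>a\<close>, \<open>b\<close>, \<open>c\<close> in the sides of the triangle \<open>F\<close> opposite to the angles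
  \<open>\<pi>/p\<close>, \<open>\<pi>/2\<close>, \<open>\<pi>/q\<close>, this is the regular tiling \<open>(q\<^sup>p)\<close> by \<open>q\<close>-gons if \<open>R = {a, b}\<close>, the
  regular tiling \<open>(p\<^sup>q)\<close> by \<open>p\<close>-gons if \<open>R = {b, c}\<close>, and the Laves tiling \<open>[p.q.p.q]\<close> by the
  quadrilaterals \<open>F \<union> aF \<union> cF \<union> acF\<close> and their images if \<open>R = {a, c}\<close>.
\<close>

definition orbit_tiling :: "('a \<Rightarrow> 'a) monoid \<Rightarrow> 'a set \<Rightarrow> ('a \<Rightarrow> 'a) set \<Rightarrow> 'a set set" where
  "orbit_tiling G F R = {g ` (\<Union>h \<in> generate G R. h ` F) | g. g \<in> carrier G}"


section \<open>Colourings\<close>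

definition colouring :: "nat \<Rightarrow> 'a set set \<Rightarrow> ('a set \<Rightarrow> nat) \<Rightarrow> bool" where
  "colouring k X c \<longleftrightarrow> c ` X = {1..k}"

definition perfect_colouring ::
    "('a \<Rightarrow> 'a) monoid \<Rightarrow> nat \<Rightarrow> 'a set set \<Rightarrow> ('a set \<Rightarrow> nat) \<Rightarrow> bool" where
  "perfect_colouring G k X c \<longleftrightarrow> colouring k X c \<and>
     (\<forall>h \<in> carrier G. \<exists>\<pi>. \<pi> permutes {1..k} \<and> (\<forall>x \<in> X. c (h ` x) = \<pi> (c x)))"

text \<open>
  \<open>C 1 = S, C 2, \<dots>, C k\<close> is a numbering of the left cosets of \<open>S\<close>, and the tile \<open>f F\<close> has
  colour \<open>i\<close> if \<open>f\<close> lies in \<open>C i\<close>.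
\<close>

definition left_coset_colouring ::
    "('a \<Rightarrow> 'a) monoid \<Rightarrow> 'a set \<Rightarrow> ('a \<Rightarrow> 'a) set \<Rightarrow> nat \<Rightarrow> ('a set \<Rightarrow> nat) \<Rightarrow> bool" where
  "left_coset_colouring G F S k c \<longleftrightarrow>
     colouring k (triangle_tiling G F) c \<and>
     (\<exists>C. bij_betw C {1..k} (lcosets\<^bsub>G\<^esub> S) \<and> C 1 = S \<and>
          (\<forall>i \<in> {1..k}. \<forall>f \<in> C i. c (f ` F) = i))"

text \<open>
  Different numberings of the cosets yield colourings that differ by a permutation of the
  colours, so it is immaterial which left coset colouring \<open>c\<close> is chosen.  Every tile of the
  tilings \<open>X\<close> considered contains triangles, so \<open>d\<close> is uniquely determined on \<open>X\<close>; its
  existence includes that all triangles in a tile have the same colour.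
\<close>

definition induces_perfect_colouring ::
    "('a \<Rightarrow> 'a) monoid \<Rightarrow> 'a set \<Rightarrow> ('a \<Rightarrow> 'a) set \<Rightarrow> nat \<Rightarrow> 'a set set \<Rightarrow> bool" where
  "induces_perfect_colouring G F S k X \<longleftrightarrow>
     (\<exists>c d. left_coset_colouring G F S k c \<and>
            (\<forall>x \<in> X. \<forall>t \<in> triangle_tiling G F. t \<subseteq> x \<longrightarrow> d x = c t) \<and>
            perfect_colouring G k X d)"

end

theory Submission
  imports Defs
begin

text \<open>
  Let \<open>R\<close> consist of the two reflections from which a tiling is built as \<open>orbit_tiling G F R\<close>.
  If the left coset colouring gives one colour to all triangles in a tile, then it does so in the
  tile that contains the base triangle \<open>F\<close>.  For \<open>r \<in> R\<close> the triangle
  \<open>r F\<close> lies in the same tile and has the same colour as \<open>F\<close>, so \<open>r\<close> lies in the coset \<open>S\<close> of the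
  identity.

  Conversely let \<open>R \<subseteq> S\<close>.  The subgroup \<open>K\<close> generated by \<open>R\<close> lies in \<open>S\<close>, so the triangles
  \<open>g h F\<close> with \<open>h \<in> K\<close>, which make up the tile \<open>g (\<Union>h\<in>K. h F)\<close>, all have the colour of the coset
  \<open>g S\<close>, and left multiplication by an element of the group permutes the cosets.  This argument
  needs two facts that are not formal: \<open>f F\<close> determines the coset of \<open>f\<close>, and a triangle \<open>f F\<close> that
  is contained in the tile of \<open>g\<close> satisfies \<open>f \<in> g K\<close>.  Both hold as soon as some point \<open>x\<close> of \<open>F\<close>
  is moved out of \<open>F\<close> by every \<open>f \<noteq> 1\<close> in the group, because then \<open>f x \<in> g F\<close> forces \<open>f = g\<close>.
  Lemma \<open>induces_perfect_colouring_iff\<close> carries out this reduction for an arbitrary group of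
  bijections.

  That an inner point of \<open>F\<close> has this property (lemma \<open>triangle_point_with_free_orbit\<close>) means that
  the images of \<open>F\<close> do not overlap.  The proof works in \<open>\<real>\<^sup>3\<close>, uniformly in the curvature: the three
  reflections are restrictions of linear maps \<open>x \<mapsto> x - 2 \<alpha>\<^sub>i(x) \<nu>\<^sub>i\<close>, where \<open>\<alpha>\<^sub>i\<close> is a
  functional that vanishes on one side of \<open>F\<close> and is positive at the opposite vertex, and the
  angles of \<open>F\<close> say exactly that \<open>\<alpha>\<^sub>i(\<nu>\<^sub>j) = - cos (\<pi> / m\<^sub>i\<^sub>j)\<close> with
  \<open>m\<^sub>i\<^sub>j \<in> {2, p, q}\<close>.  The cone over \<open>F\<close> is the chamber on which all \<open>\<alpha>\<^sub>i\<close> are nonnegative, and a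
  theorem of Tits about the geometric representation of Coxeter groups
  (\<open>chamber_point_leaves_closed_chamber\<close>) says that a nontrivial product of such reflections takes
  no inner point of the chamber back into it.
\<close>


section \<open>Groups generated by linear reflections\<close>

text \<open>
  The geometric representation of a Coxeter group in its dual form: the simple roots \<open>\<alpha> i\<close> are
  linear functionals, and the \<open>\<nu> i\<close> are the coroots.  In this form the matrix of the
  \<open>\<alpha> i (\<nu> j)\<close> may be singular, as happens for the Euclidean triangle groups, where the coroots lie
  in a plane.
\<close>
locale reflection_system =
  fixes \<alpha> :: "'i \<Rightarrow> 'v::real_vector \<Rightarrow> real"
    and \<nu> :: "'i \<Rightarrow> 'v"
    and m :: "'i \<Rightarrow> 'i \<Rightarrow> nat"
  assumes linear_root: "linear (\<alpha> i)"
    and root_coroot_self: "\<alpha> i (\<nu> i) = 1"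
    and m_sym: "m i j = m j i"
    and m_ge_2: "i \<noteq> j \<Longrightarrow> m i j \<ge> 2"
    and root_coroot: "i \<noteq> j \<Longrightarrow> \<alpha> i (\<nu> j) = - cos (pi / real (m i j))"
begin

definition reflect :: "'i \<Rightarrow> 'v \<Rightarrow> 'v" where
  "reflect i x = x - (2 * \<alpha> i x) *\<^sub>R \<nu> i"

definition act :: "'i list \<Rightarrow> 'v \<Rightarrow> 'v" where
  "act w = foldr reflect w"

lemma act_simps [simp]: "act [] x = x" "act (i # w) x = reflect i (act w x)"
  "act (v @ w) x = act v (act w x)"
  by (simp_all add: act_def)

lemma root_diff_scale: "\<alpha> i (x - r *\<^sub>R y) = \<alpha> i x - r * \<alpha> i y"
  by (simp add: linear_diff[OF linear_root] linear_scale[OF linear_root])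

lemma root_reflect_self: "\<alpha> i (reflect i x) = - \<alpha> i x"
  by (simp add: reflect_def root_diff_scale root_coroot_self)

lemma root_reflect:
  "i \<noteq> j \<Longrightarrow> \<alpha> i (reflect j x) = \<alpha> i x + 2 * cos (pi / real (m i j)) * \<alpha> j x"
  by (simp add: reflect_def root_diff_scale root_coroot)

lemma reflect_reflect [simp]: "reflect i (reflect i x) = x"
  by (simp add: reflect_def root_diff_scale root_coroot_self scaleR_left_distrib[symmetric])

text \<open>
  The reduced words of the dihedral group generated by two reflections are alternating ones.
\<close>
fun alternating :: "'i \<Rightarrow> 'i \<Rightarrow> nat \<Rightarrow> 'i list" where
  "alternating s t 0 = []"
| "alternating s t (Suc n) = s # alternating t s n"

lemma length_alternating [simp]: "length (alternating s t n) = n"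
  by (induction n arbitrary: s t) auto

lemma set_alternating: "set (alternating s t n) \<subseteq> {s, t}"
  by (induction n arbitrary: s t) auto

lemma alternating_add:
  "\<exists>w. set w \<subseteq> {s, t} \<and> length w = k \<and> alternating s t (n + k) = alternating s t n @ w"
proof (induction n arbitrary: s t)
  case 0
  show ?case using set_alternating[of s t k] by (intro exI[of _ "alternating s t k"]) auto
next
  case (Suc n)
  from Suc[of t s] show ?case by auto
qed

lemma distinct_adj_alternating:
  assumes "distinct_adj w" "set w \<subseteq> {s, t}" "w = [] \<or> hd w \<noteq> s"
  shows "w = alternating t s (length w)"
  using assms
proof (induction w arbitrary: s t)
  case (Cons x w)
  then have "x = t" by auto
  moreover have "w = alternating s t (length w)"
    using Cons.prems \<open>x = t\<close> by (intro Cons.IH) (auto simp: distinct_adj_Cons)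
  ultimately show ?case by simp
qed simp

text \<open>
  On the plane spanned by the roots \<open>\<alpha> s\<close> and \<open>\<alpha> t\<close> the product of the two reflections is a
  rotation by \<open>2 \<theta>\<close>, which shifts the coefficients \<open>sin (k \<theta>)\<close> of a combination.  The
  case \<open>k = 0\<close> is the explicit form of the root \<open>\<alpha> s\<close> after an alternating word; general \<open>k\<close> makes
  the induction over the word possible, since each letter raises \<open>k\<close> by one and exchanges the roles
  of \<open>s\<close> and \<open>t\<close>.
\<close>
lemma root_alternating:
  assumes "s \<noteq> t"
  defines "\<theta> \<equiv> pi / real (m s t)"
  shows "sin (real (k + 1) * \<theta>) * \<alpha> s (act (alternating t s n) x)
         + sin (real k * \<theta>) * \<alpha> t (act (alternating t s n) x) =
         sin (real (k + n + 1) * \<theta>) * \<alpha> (if even n then s else t) x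
         + sin (real (k + n) * \<theta>) * \<alpha> (if even n then t else s) x"
  using assms(1) unfolding \<theta>_def
proof (induction n arbitrary: s t k)
  case (Suc n)
  let ?\<theta> = "pi / real (m s t)"
  let ?z = "act (alternating s t n) x"
  have trig: "2 * cos ?\<theta> * sin (real (k + 1) * ?\<theta>) - sin (real k * ?\<theta>)
              = sin (real (k + 2) * ?\<theta>)"
  proof -
    have "real (k + 2) * ?\<theta> = real (k + 1) * ?\<theta> + ?\<theta>" "real k * ?\<theta> = real (k + 1) * ?\<theta> - ?\<theta>"
      by (simp_all add: algebra_simps add_divide_distrib)
    then show ?thesis
      by (simp only: sin_add sin_diff) (simp add: algebra_simps)
  qed
  have "sin (real (k + 1) * ?\<theta>) * \<alpha> s (reflect t ?z) + sin (real k * ?\<theta>) * \<alpha> t (reflect t ?z)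
        = sin (real (k + 1) * ?\<theta>) * \<alpha> s ?z
          + (2 * cos ?\<theta> * sin (real (k + 1) * ?\<theta>) - sin (real k * ?\<theta>)) * \<alpha> t ?z"
    using Suc.prems by (simp add: root_reflect root_reflect_self algebra_simps)
  also have "\<dots> = sin (real (Suc k + 1) * ?\<theta>) * \<alpha> t ?z + sin (real (Suc k) * ?\<theta>) * \<alpha> s ?z"
    unfolding trig by simp
  also have "\<dots> = sin (real (Suc k + n + 1) * ?\<theta>) * \<alpha> (if even n then t else s) x
         + sin (real (Suc k + n) * ?\<theta>) * \<alpha> (if even n then s else t) x"
    using Suc.IH[of t s "Suc k"] Suc.prems by (simp add: m_sym)
  finally show ?case by simp
qed simp

lemma sin_angle_pos: 
  assumes "s \<noteq> t" "0 < n" "n < m s t" 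
  shows "sin (real n * (pi / real (m s t))) > 0"
  using assms m_ge_2[OF assms(1)] by (intro sin_gt_zero) (auto simp: field_simps)

text \<open>
  For words shorter than \<open>m s t\<close> both sines in \<open>root_alternating\<close> are nonnegative.
\<close>
lemma root_alternating_pos:
  assumes "s \<noteq> t" "n < m s t" "\<alpha> s x > 0" "\<alpha> t x > 0"
  shows "\<alpha> s (act (alternating t s n) x) > 0"
proof -
  define \<theta> where "\<theta> = pi / real (m s t)"
  have m: "m s t \<ge> 2" using assms(1) by (rule m_ge_2)
  have 1: "sin \<theta> > 0"
    using sin_angle_pos[of s t 1] assms(1) m by (simp add: \<theta>_def)
  have 2: "sin (real (n + 1) * \<theta>) \<ge> 0"
  proof (rule sin_ge_zero)
    have "real (n + 1) * pi \<le> real (m s t) * pi"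
      using assms(2) by (intro mult_right_mono) auto
    then show "real (n + 1) * \<theta> \<le> pi" using m by (simp add: \<theta>_def field_simps)
  qed (simp add: \<theta>_def)
  have "sin (real (n + 1) * \<theta>) * \<alpha> (if even n then s else t) x
        + sin (real n * \<theta>) * \<alpha> (if even n then t else s) x > 0"
  proof (cases "n = 0")
    case True
    then show ?thesis using 1 assms(3) by simp
  next
    case False
    then have "sin (real n * \<theta>) > 0"
      using assms sin_angle_pos unfolding \<theta>_def by blast
    then show ?thesis
      using 2 assms(3,4) by (intro add_nonneg_pos mult_nonneg_nonneg mult_pos_pos) auto
  qed
  then have "sin \<theta> * \<alpha> s (act (alternating t s n) x) > 0"
    using root_alternating[OF assms(1), of 0 n x] by (simp add: \<theta>_def)
  then show ?thesis using 1 by (simp add: zero_less_mult_iff)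
qed

lemma act_dihedral_shift:
  assumes "set w \<subseteq> {s, t}"
  shows "\<exists>a b. act w x = x + a *\<^sub>R \<nu> s + b *\<^sub>R \<nu> t"
  using assms
proof (induction w)
  case (Cons i w)
  then obtain a b where ab: "act w x = x + a *\<^sub>R \<nu> s + b *\<^sub>R \<nu> t" by auto
  define r where "r = 2 * \<alpha> i (act w x)"
  have "act (i # w) x = act w x - r *\<^sub>R \<nu> i" by (simp add: reflect_def r_def)
  then have "act (i # w) x = x + (a - r) *\<^sub>R \<nu> s + b *\<^sub>R \<nu> t
     \<or> act (i # w) x = x + a *\<^sub>R \<nu> s + (b - r) *\<^sub>R \<nu> t"
    using Cons.prems ab by (auto simp: algebra_simps)
  then show ?case by blast
qed (auto intro: exI[of _ 0])

text \<open>
  The dihedral group moves points only along the span of the two coroots, where the two roots are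
  coordinates because their Gram determinant is \<open>sin\<^sup>2 (\<pi> / m s t) \<noteq> 0\<close>.
\<close>
lemma act_dihedral_eqI:
  assumes "s \<noteq> t" "set v \<subseteq> {s, t}" "set w \<subseteq> {s, t}"
    and "\<alpha> s (act v x) = \<alpha> s (act w x)" "\<alpha> t (act v x) = \<alpha> t (act w x)"
  shows "act v x = act w x"
proof -
  obtain a b a' b' where v: "act v x = x + a *\<^sub>R \<nu> s + b *\<^sub>R \<nu> t"
    and w: "act w x = x + a' *\<^sub>R \<nu> s + b' *\<^sub>R \<nu> t"
    using act_dihedral_shift[OF assms(2)] act_dihedral_shift[OF assms(3)] by metis
  define c where "c = cos (pi / real (m s t))"
  have root_add: "\<alpha> i (y + z) = \<alpha> i y + \<alpha> i z" "\<alpha> i (r *\<^sub>R y) = r * \<alpha> i y" for i y z r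
    by (simp_all add: linear_add[OF linear_root] linear_scale[OF linear_root])
  have 1: "(a - a') - c * (b - b') = 0" "(b - b') - c * (a - a') = 0"
    using assms(4,5) assms(1)
    by (simp_all add: v w root_add root_coroot root_coroot_self m_sym[of t s] c_def algebra_simps)
  have "sin (pi / real (m s t)) > 0"
    using sin_angle_pos[of s t 1] m_ge_2[OF assms(1)] assms(1) by simp
  then have "(sin (pi / real (m s t)))\<^sup>2 \<noteq> 0" by simp
  then have "c\<^sup>2 \<noteq> 1" using sin_cos_squared_add[of "pi / real (m s t)"]
    unfolding c_def by linarith
  moreover have "(b - b') * (1 - c\<^sup>2) = 0" using 1 by algebra
  ultimately have "b = b'" by simp
  with 1 have "a = a'" by simp
  show ?thesis using v w \<open>a = a'\<close> \<open>b = b'\<close> by simp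
qed

text \<open>
  At word length \<open>m s t\<close> the angle in \<open>root_alternating\<close> has reached \<open>\<pi>\<close>, and both words send
  each root to the negative of the same root.
\<close>
lemma braid_relation:
  assumes "s \<noteq> t"
  shows "act (alternating s t (m s t)) = act (alternating t s (m s t))"
proof
  fix x
  have root_eq: "\<alpha> s (act (alternating s t (m s t)) x) = \<alpha> s (act (alternating t s (m s t)) x)"
    if "s \<noteq> t" for s t
  proof -
    define \<theta> where "\<theta> = pi / real (m s t)"
    have m: "m s t \<ge> 2" using that by (rule m_ge_2)
    then obtain n where n: "m s t = Suc n" by (cases "m s t") auto
    have s1: "sin \<theta> > 0" using sin_angle_pos[of s t 1] that m by (simp add: \<theta>_def)
    have mt: "real (m s t) * \<theta> = pi" using m by (simp add: \<theta>_def)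
    then have m1: "real (m s t + 1) * \<theta> = \<theta> + pi" "real n * \<theta> = pi - \<theta>" 
      "real (n + 1) * \<theta> = pi"
      using n by (simp_all add: algebra_simps)
    have "sin \<theta> * \<alpha> s (act (alternating t s (m s t)) x)
          = - sin \<theta> * \<alpha> (if even (m s t) then s else t) x"
      using root_alternating[OF that, of 0 "m s t" x, folded \<theta>_def] mt m1 by simp
    moreover have "sin (real n * \<theta>) = sin \<theta>" by (simp only: m1 sin_pi_minus)
    then have "sin \<theta> * \<alpha> s (act (alternating s t (m s t)) x)
          = - sin \<theta> * \<alpha> (if even (m s t) then s else t) x"
      using root_alternating[OF that, of 0 n x, folded \<theta>_def] m1(3)
      by (auto simp: n root_reflect_self)
    ultimately have "sin \<theta> * \<alpha> s (act (alternating s t (m s t)) x)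
      = sin \<theta> * \<alpha> s (act (alternating t s (m s t)) x)" by simp
    with s1 show ?thesis by simp
  qed
  show "act (alternating s t (m s t)) x = act (alternating t s (m s t)) x"
    using set_alternating[of s t "m s t"] set_alternating[of t s "m s t"]
      root_eq[OF assms] root_eq[OF assms[symmetric]]
    by (intro act_dihedral_eqI[OF assms]) (auto simp: m_sym)
qed

definition reduced :: "'i list \<Rightarrow> bool" where
  "reduced w \<longleftrightarrow> (\<forall>u. act u = act w \<longrightarrow> length w \<le> length u)"

lemma reducedD: "reduced w \<Longrightarrow> (\<And>x. act u x = act w x) \<Longrightarrow> length w \<le> length u"
  by (auto simp: reduced_def)

text \<open>
  The theorem of Tits: if a reduced word \<open>w\<close> does not get shorter on multiplication by \<open>s\<close>, then
  \<open>w\<close> takes the open chamber to the positive side of the mirror of \<open>s\<close>.  If \<open>w\<close> starts with \<open>t\<close>,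
  split off from \<open>w\<close> as long a prefix in the dihedral group of \<open>s\<close> and \<open>t\<close> as possible.
  By induction the remaining word takes the chamber into the sector where \<open>\<alpha> s\<close> and \<open>\<alpha> t\<close> are
  positive, and the dihedral prefix is too short to carry this sector across the mirror of \<open>s\<close>.
  Comparing with the length of \<open>w\<close> in the second hypothesis, rather than with that of \<open>s # w\<close>,
  keeps the parity of word lengths out of the induction.
\<close>
theorem root_pos_if_not_shortened:
  assumes "reduced w" "\<And>u. act u = act (s # w) \<Longrightarrow> length w \<le> length u"
    and "\<And>i. \<alpha> i x > 0"
  shows "\<alpha> s (act w x) > 0"
  using assms(1,2)
proof (induction "length w" arbitrary: s w rule: less_induct)
  case less
  note red = reducedD[OF less.prems(1)]
  have no_short: "length w \<le> length u" if "\<And>y. act u y = act (s # w) y" for u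
    using that by (intro less.prems(2)) auto
  show ?case
  proof (cases w)
    case Nil
    then show ?thesis using assms(3) by simp
  next
    case (Cons t w')
    have "s \<noteq> t"
      using no_short[of w'] Cons by auto
    \<comment> \<open>Factorisations of \<open>w\<close>, no longer than \<open>w\<close>, with first factor in the dihedral group of
      \<open>s\<close> and \<open>t\<close>; one with shortest second factor is the required splitting.\<close>
    define ok where "ok = (\<lambda>(i, v). set i \<subseteq> {s, t} \<and> act (i @ v) = act w \<and> 
      length i + length v \<le> length w)"
    have ok0: "ok ([t], w')" by (auto simp: ok_def Cons)
    define p where "p = arg_min (\<lambda>(i, v). length v) ok"
    obtain i v where p: "p = (i, v)" by force
    have "ok p" and min: "\<And>q. ok q \<Longrightarrow> length v \<le> length (snd q)"
      using arg_min_nat_lemma[of ok "([t], w')" "\<lambda>(i, v). length v", folded p_def] ok0 p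
      by (auto simp: case_prod_unfold)
    then have iv: "set i \<subseteq> {s, t}" "act (i @ v) = act w" "length i + length v \<le> length w"
      by (auto simp: ok_def p)
    then have act_iv: "act w x = act i (act v x)" for x
      by (metis act_simps(3))
    have v_short: "length v < length w"
      using min[OF ok0] by (simp add: Cons)
    have "reduced v"
      unfolding reduced_def
    proof safe
      fix u assume "act u = act v"
      then show "length v \<le> length u"
        using red[of "i @ u"] iv(3) act_iv by simp
    qed
    \<comment> \<open>If \<open>r\<close> shortened \<open>v\<close>, it could be moved to the dihedral factor.\<close>
    moreover have "length v \<le> length u" if r: "r \<in> {s, t}" and u: "act u = act (r # v)" for r u
    proof (rule ccontr)
      assume "\<not> length v \<le> length u"
      then have "ok (i @ [r], u)"
        using iv r u by (auto simp: ok_def act_iv fun_eq_iff)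
      with min[of "(i @ [r], u)"] \<open>\<not> length v \<le> length u\<close> show False by simp
    qed
    ultimately have pos: "\<alpha> r (act v x) > 0" if "r \<in> {s, t}" for r
      using less.hyps[OF v_short] that by blast
    have "distinct_adj i"
    proof (rule ccontr)
      assume "\<not> distinct_adj i"
      then obtain k where k: "Suc k < length i" "i ! k = i ! Suc k"
        by (auto simp: distinct_adj_conv_nth)
      then have i: "i = take k i @ i ! k # i ! k # drop (Suc (Suc k)) i"
        by (metis Cons_nth_drop_Suc Suc_lessD append_take_drop_id)
      have "act (take k i @ drop (Suc (Suc k)) i @ v) y = act w y" for y
        unfolding act_iv by (subst (3) i) simp
      from red[OF this] iv(3) k(1) show False by simp
    qed
    moreover have "i = [] \<or> hd i \<noteq> s"
    proof (rule ccontr)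
      assume "\<not> (i = [] \<or> hd i \<noteq> s)"
      then obtain i' where "i = s # i'" by (cases i) auto
      then show False using no_short[of "i' @ v"] iv(3) act_iv by simp
    qed
    ultimately have i: "i = alternating t s (length i)"
      using iv(1) by (intro distinct_adj_alternating) auto
    \<comment> \<open>Otherwise the braid relation gives a word for \<open>i\<close> that starts with \<open>s\<close>, which \<open>s\<close> shortens.\<close>
    have "length i < m s t"
    proof (rule ccontr)
      assume "\<not> length i < m s t"
      then obtain k where k: "length i = m s t + k"
        by (meson le_Suc_ex not_less)
      obtain j where j: "length j = k" "alternating t s (m s t + k) = alternating t s (m s t) @ j"
        using alternating_add by blast
      obtain n where n: "m s t = Suc n" using m_ge_2[OF \<open>s \<noteq> t\<close>] by (cases "m s t") auto
      have "act i y = act (s # alternating t s n @ j) y" for y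
      proof -
        have "act i y = act (alternating t s (m s t)) (act j y)"
          by (subst i, subst k, subst j(2)) simp
        also have "\<dots> = act (alternating s t (m s t)) (act j y)"
          using braid_relation[OF \<open>s \<noteq> t\<close>] by simp
        finally show ?thesis by (simp add: n)
      qed
      then show False
        using no_short[of "alternating t s n @ j @ v"] iv(3) k j(1) n by (simp add: act_iv)
    qed
    then show ?thesis
      unfolding act_iv by (subst i) (intro root_alternating_pos[OF \<open>s \<noteq> t\<close>] pos; simp)
  qed
qed

text \<open>
  If \<open>s\<close> is the first letter of a shortest word for a nontrivial element, then the rest of the word
  keeps the chamber on the positive side of the mirror of \<open>s\<close>, and \<open>s\<close> throws it to the negative
  side.
\<close>
corollary chamber_point_leaves_closed_chamber:
  assumes "\<And>i. \<alpha> i x > 0" "\<And>i. \<alpha> i (act w x) \<ge> 0"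
  shows "act w y = y"
proof -
  define v where "v = arg_min length (\<lambda>v. act v = act w)"
  have v: "act v = act w" and min: "\<And>u. act u = act w \<Longrightarrow> length v \<le> length u"
    using arg_min_nat_lemma[of "\<lambda>v. act v = act w" w length, folded v_def] by auto
  show ?thesis
  proof (cases v)
    case Nil
    with v have "act w = act []" by simp
    then show ?thesis by simp
  next
    case (Cons s u)
    have "\<alpha> s (act u x) > 0"
    proof (rule root_pos_if_not_shortened)
      show "reduced u"
        unfolding reduced_def
      proof safe
        fix u' assume "act u' = act u"
        then have "act (s # u') = act w" using v Cons by (auto simp: fun_eq_iff)
        from min[OF this] show "length u \<le> length u'" using Cons by simp
      qed
      show "length u \<le> length u'" if "act u' = act (s # u)" for u'
        using min[of u'] that v Cons by simp
    qed (use assms in auto)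
    then have "\<alpha> s (act w x) < 0"
      using Cons by (simp add: v[symmetric] root_reflect_self)
    with assms(2)[of s] show ?thesis by simp
  qed
qed

end

section \<open>Reflections and normals on the surfaces of constant curvature\<close>

unbundle cross3_syntax
text \<open>
  A vector \<open>u\<close> stands for the functional \<open>x \<mapsto> u \<bullet> x\<close>, and \<open>sharp \<kappa> u\<close> is the corresponding
  vector with respect to the bilinear form.  The form is degenerate for \<open>\<kappa> = 0\<close>, but as a form on
  functionals it still makes sense and measures the angle between lines; this allows one treatment
  of all three geometries.
\<close>
definition sharp :: "real \<Rightarrow> real^3 \<Rightarrow> real^3" where
  "sharp \<kappa> u = vector [u$1, u$2, \<kappa> * u$3]"

lemma sharp_components [simp]: "sharp \<kappa> u $ 1 = u$1" "sharp \<kappa> u $ 2 = u$2" "sharp \<kappa> u $ 3 = \<kappa> * u$3"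
  by (simp_all add: sharp_def)

lemma inner_sharp: "u \<bullet> sharp \<kappa> v = form \<kappa> u v"
  by (simp add: form_def inner_vec_def sum_3)

lemma form_scale: "form \<kappa> (r *\<^sub>R u) (s *\<^sub>R v) = r * s * form \<kappa> u v"
  by (simp add: form_def algebra_simps)

lemma form_commute: "form \<kappa> u v = form \<kappa> v u"
  by (simp add: form_def algebra_simps)

lemma cross_inner_cycle: "(x \<times> y) \<bullet> z = (y \<times> z) \<bullet> x" "(x \<times> y) \<bullet> z = (z \<times> x) \<bullet> y" for x :: "real^3"
  by (simp_all add: cross3_simps)

lemma surface_cases:
  assumes "\<kappa> \<in> {1, 0, -1}" "x \<in> surface \<kappa>"
  obtains "\<kappa> = 1" "(x$1)\<^sup>2 + (x$2)\<^sup>2 + (x$3)\<^sup>2 = 1" | "\<kappa> = 0" "x$3 = 1"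
  | "\<kappa> = -1" "(x$3)\<^sup>2 = 1 + (x$1)\<^sup>2 + (x$2)\<^sup>2" "x$3 > 0"
proof -
  have "norm x = 1 \<longleftrightarrow> (x$1)\<^sup>2 + (x$2)\<^sup>2 + (x$3)\<^sup>2 = 1"
    by (simp add: norm_eq_1 inner_vec_def sum_3 power2_eq_square)
  with assms that show thesis
    by (auto simp: surface_def form_def power2_eq_square algebra_simps)
qed

text \<open>
  The plane through the origin that cuts out the geodesic from \<open>A\<close> to \<open>B\<close> has normal \<open>A \<times> B\<close>, and
  turning the tangent plane at \<open>A\<close> by a right angle takes the direction of the geodesic to this
  normal.  Hence angles between directions can be read off from normals.
\<close>
lemma form_cross_cross:
  assumes \<kappa>: "\<kappa> \<in> {1, 0, -1}" and "A \<in> surface \<kappa>" "B \<in> surface \<kappa>" "C \<in> surface \<kappa>"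
  shows "form \<kappa> (A \<times> B) (A \<times> C) = form \<kappa> (direction \<kappa> A B) (direction \<kappa> A C)"
proof (cases "\<kappa> = 0")
  case True
  then have "A$3 = 1" "B$3 = 1" "C$3 = 1" using assms by (auto simp: surface_def)
  with True show ?thesis by (simp add: form_def direction_def cross_components algebra_simps)
next
  case False
  then have kk1: "\<kappa> = 1 \<or> \<kappa> = -1" and kk: "\<kappa> * \<kappa> = 1" using \<kappa> by auto
  have AA: "form \<kappa> A A = \<kappa>"
    using \<kappa> assms(2) False
    by (cases rule: surface_cases) (auto simp: form_def power2_eq_square algebra_simps)
  have dir: "direction \<kappa> A D = D - (\<kappa> * form \<kappa> A D) *\<^sub>R A" for D
  proof -
    have "form \<kappa> A (D - A) = form \<kappa> A D - form \<kappa> A A"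
      by (simp add: form_def algebra_simps)
    then have "\<kappa> * form \<kappa> A (D - A) = \<kappa> * form \<kappa> A D - 1"
      using kk by (simp add: AA right_diff_distrib)
    then show ?thesis by (simp add: direction_def scaleR_left_diff_distrib)
  qed
  have bil: "form \<kappa> (B - r *\<^sub>R A) (C - s *\<^sub>R A)
      = form \<kappa> B C - s * form \<kappa> A B - r * form \<kappa> A C + r * s * form \<kappa> A A" for r s
    by (simp add: form_def algebra_simps)
  have "form \<kappa> (direction \<kappa> A B) (direction \<kappa> A C)
      = form \<kappa> B C - \<kappa> * form \<kappa> A B * form \<kappa> A C"
    unfolding dir bil AA using kk1 by (auto simp: algebra_simps)
  also have "\<dots> = \<kappa> * (form \<kappa> A A * form \<kappa> B C - form \<kappa> A B * form \<kappa> A C)"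
    using kk by (simp add: AA right_diff_distrib mult.assoc[symmetric])
  also have "\<dots> = form \<kappa> (A \<times> B) (A \<times> C)"
    using kk1 by (elim disjE) (simp_all add: form_def cross_components algebra_simps)
  finally show ?thesis ..
qed

text \<open>
  The Cauchy-Schwarz inequality for normals of geodesics through \<open>A\<close>, with its defect: both normals
  lie in the plane orthogonal to \<open>A\<close>, where the form is definite.
\<close>
lemma gram_cross:
  assumes \<kappa>: "\<kappa> \<in> {1, 0, -1}" and "A \<in> surface \<kappa>"
  shows "form \<kappa> (A \<times> B) (A \<times> B) * form \<kappa> (A \<times> C) (A \<times> C) - (form \<kappa> (A \<times> B) (A \<times> C))\<^sup>2
     = ((A \<times> B) \<bullet> C)\<^sup>2"
proof -
  have A: "(A$3)\<^sup>2 + \<kappa> * ((A$1)\<^sup>2 + (A$2)\<^sup>2) = 1"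
    using assms by (cases rule: surface_cases) auto
  have "form \<kappa> (A \<times> B) (A \<times> B) * form \<kappa> (A \<times> C) (A \<times> C) - (form \<kappa> (A \<times> B) (A \<times> C))\<^sup>2
     = ((A \<times> B) \<bullet> C)\<^sup>2 * ((A$3)\<^sup>2 + \<kappa> * ((A$1)\<^sup>2 + (A$2)\<^sup>2))"
    unfolding form_def cross_components inner_vec_def sum_3 inner_real_def by algebra
  with A show ?thesis by simp
qed

text \<open>The reversed Cauchy-Schwarz inequality for time-like vectors.\<close>
lemma hyperbolic_form_le:
  assumes "x \<in> surface (-1)" "y \<in> surface (-1)"
  shows "- form (-1) x y \<ge> 1" and "- form (-1) x y = 1 \<Longrightarrow> x = y"
proof -
  have x: "(x$3)\<^sup>2 = 1 + (x$1)\<^sup>2 + (x$2)\<^sup>2" "x$3 > 0" and y: "(y$3)\<^sup>2 = 1 + (y$1)\<^sup>2 + (y$2)\<^sup>2" "y$3 > 0"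
    using assms by (auto simp: surface_def form_def power2_eq_square algebra_simps)
  let ?d = "x$1 * y$1 + x$2 * y$2"
  have id: "(x$3 * y$3)\<^sup>2 = (1 + ?d)\<^sup>2 + (x$1 - y$1)\<^sup>2 + (x$2 - y$2)\<^sup>2 + (x$1 * y$2 - x$2 * y$1)\<^sup>2"
    unfolding power_mult_distrib x y by (simp add: power2_eq_square algebra_simps)
  then have "(1 + ?d)\<^sup>2 \<le> (x$3 * y$3)\<^sup>2" by simp
  then have "1 + ?d \<le> x$3 * y$3" using x y by (intro power2_le_imp_le[of "1 + ?d"]) auto
  then show "- form (-1) x y \<ge> 1" by (simp add: form_def)
  assume "- form (-1) x y = 1"
  then have "x$3 * y$3 = 1 + ?d" by (simp add: form_def)
  with id have "(x$1 - y$1)\<^sup>2 + (x$2 - y$2)\<^sup>2 + (x$1 * y$2 - x$2 * y$1)\<^sup>2 = 0" by simp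
  then have 12: "x$1 = y$1" "x$2 = y$2"
    by (simp_all add: add_nonneg_eq_0_iff)
  then have "x$3 = y$3" using x y by (metis less_imp_le power2_eq_imp_eq)
  with 12 show "x = y" by (simp add: vec_eq_iff forall_3)
qed

lemma form_normal_pos:
  assumes \<kappa>: "\<kappa> \<in> {1, 0, -1}" and A: "A \<in> surface \<kappa>" and B: "B \<in> surface \<kappa>" and nz: "A \<times> B \<noteq> 0"
  shows "form \<kappa> (A \<times> B) (A \<times> B) > 0"
  using \<kappa> A
proof (cases rule: surface_cases)
  case 1
  then have "form \<kappa> (A \<times> B) (A \<times> B) = (A \<times> B) \<bullet> (A \<times> B)"
    by (simp add: form_def inner_vec_def sum_3)
  then show ?thesis using nz by simp
next
  case 2
  have "B$3 = 1" using B 2 by (auto simp: surface_def)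
  have "A$1 \<noteq> B$1 \<or> A$2 \<noteq> B$2"
  proof (rule ccontr)
    assume "\<not> ?thesis"
    then have "A = B" using 2 \<open>B$3 = 1\<close> by (simp add: vec_eq_iff forall_3)
    with nz show False by simp
  qed
  then show ?thesis using 2 \<open>B$3 = 1\<close>
    by (auto simp: form_def cross_components power2_eq_square[symmetric] 
        intro: add_pos_nonneg add_nonneg_pos)
next
  case 3
  have B3: "(B$3)\<^sup>2 = 1 + (B$1)\<^sup>2 + (B$2)\<^sup>2" "B$3 > 0"
    using B 3 by (auto simp: surface_def form_def power2_eq_square algebra_simps)
  have "A \<noteq> B" using nz by auto
  then have "- form (-1) A B > 1" 
    using hyperbolic_form_le[of A B] A B 3 by fastforce
  then have "(form (-1) A B)\<^sup>2 > 1" 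
    by (metis one_less_power power2_minus pos2)
  moreover have "form (-1) (A \<times> B) (A \<times> B) = (form (-1) A B)\<^sup>2 - 1"
    unfolding form_def cross_components using 3(2) B3(1) by algebra
  ultimately show ?thesis using 3 by simp
qed

lemma isometry_form:
  assumes "\<kappa> \<in> {1, -1}" "r \<in> isometries \<kappa>" "x \<in> surface \<kappa>" "y \<in> surface \<kappa>"
  shows "form \<kappa> (r x) (r y) = form \<kappa> x y"
proof -
  have r: "r x \<in> surface \<kappa>" "r y \<in> surface \<kappa>"
    using assms Bij_imp_funcset by (auto simp: isometries_def)
  have d: "geo_dist \<kappa> (r x) (r y) = geo_dist \<kappa> x y"
    using assms by (auto simp: isometries_def)
  from assms(1) consider "\<kappa> = 1" | "\<kappa> = -1" by auto
  then show ?thesis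
  proof cases
    case 1
    have "\<bar>u \<bullet> v\<bar> \<le> 1" if "u \<in> surface \<kappa>" "v \<in> surface \<kappa>" for u v :: "real^3"
      using Cauchy_Schwarz_ineq2[of u v] that 1 by (simp add: surface_def)
    then have "r x \<bullet> r y = x \<bullet> y"
      using d 1 r assms(3,4) by (simp add: geo_dist_def arccos_eq_iff)
    then show ?thesis using 1 by (simp add: form_def inner_vec_def sum_3)
  next
    case 2
    have "arcosh (- form \<kappa> (r x) (r y)) = arcosh (- form \<kappa> x y)"
      using d 2 by (simp add: geo_dist_def)
    moreover have "- form \<kappa> (r x) (r y) \<ge> 1" "- form \<kappa> x y \<ge> 1"
      using hyperbolic_form_le(1) r assms(3,4) 2 by blast+
    ultimately show ?thesis
      by (metis cosh_arcosh_real neg_equal_iff_equal)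
  qed
qed

lemma orthogonal_imp_multiple_cross:
  fixes A B e :: "real^3"
  assumes "A \<times> B \<noteq> 0" "e \<bullet> A = 0" "e \<bullet> B = 0"
  obtains t where "e = t *\<^sub>R (A \<times> B)"
proof -
  have "(A \<times> B) \<times> e = (e \<bullet> A) *\<^sub>R B - (e \<bullet> B) *\<^sub>R A"
    by (simp add: cross3_simps forall_3)
  then have "(A \<times> B) \<times> e = 0" using assms(2,3) by simp
  then show thesis
    using assms(1) that by (auto simp: cross_eq_0 collinear_lemma)
qed

text \<open>
  The displacement of a point \<open>x\<close> is orthogonal to the mirror, because distances to \<open>A\<close> and \<open>B\<close> are
  preserved; this leaves a line on which one quadratic equation singles out \<open>x\<close> and its mirror
  image, and \<open>x\<close> is fixed only if it lies on the mirror.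
\<close>
lemma reflection_formula:
  assumes \<kappa>: "\<kappa> \<in> {1, 0, -1}" and A: "A \<in> surface \<kappa>" and B: "B \<in> surface \<kappa>" and nz: "A \<times> B \<noteq> 0"
    and r: "is_reflection \<kappa> (geodesic_line \<kappa> A B) r" and x: "x \<in> surface \<kappa>"
    and n: "n = s *\<^sub>R (A \<times> B)" "form \<kappa> n n = 1"
  shows "r x = x - (2 * (n \<bullet> x)) *\<^sub>R sharp \<kappa> n"
proof -
  have iso: "r \<in> isometries \<kappa>" and fixed: "{x \<in> surface \<kappa>. r x = x} = surface \<kappa> \<inter> span {A, B}"
    using r by (auto simp: is_reflection_def geodesic_line_def)
  have rA: "r A = A" and rB: "r B = B"
    using fixed A B by (auto intro: span_base)
  have nA: "n \<bullet> A = 0" and nB: "n \<bullet> B = 0"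
    by (simp_all add: n dot_cross_self)
  have rx: "r x \<in> surface \<kappa>"
    using iso x Bij_imp_funcset by (auto simp: isometries_def)
  define d where "d = r x - x"
  have rxd: "r x = x + d" by (simp add: d_def)
  have s: "s \<noteq> 0" using n by (auto simp: form_def)
  have "\<exists>t. d = t *\<^sub>R sharp \<kappa> n \<and> t * (t + 2 * (n \<bullet> x)) = 0"
  proof (cases "\<kappa> = 0")
    case False
    then have k: "\<kappa> \<in> {1, -1}" using \<kappa> by auto
    then have kk: "\<kappa> * \<kappa> = 1" by auto
    have "sharp \<kappa> d \<bullet> A = 0" "sharp \<kappa> d \<bullet> B = 0"
      using isometry_form[OF k iso x A] isometry_form[OF k iso x B]
      by (simp_all add: rA rB d_def form_def inner_vec_def sum_3 algebra_simps)
    then obtain t where "sharp \<kappa> d = t *\<^sub>R (A \<times> B)"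
      using orthogonal_imp_multiple_cross nz by blast
    then have "sharp \<kappa> d = (t / s) *\<^sub>R n" using s by (simp add: n)
    then have "sharp \<kappa> (sharp \<kappa> d) = (t / s) *\<^sub>R sharp \<kappa> n"
      by (simp add: vec_eq_iff forall_3)
    moreover have "sharp \<kappa> (sharp \<kappa> d) = d"
      using kk by (simp add: vec_eq_iff forall_3 mult.assoc[symmetric])
    ultimately obtain t where t: "d = t *\<^sub>R sharp \<kappa> n" by auto
    have "form \<kappa> (x + t *\<^sub>R sharp \<kappa> n) (x + t *\<^sub>R sharp \<kappa> n) = form \<kappa> x x"
      using isometry_form[OF k iso x x] by (simp add: rxd t)
    moreover have "form \<kappa> (x + t *\<^sub>R sharp \<kappa> n) (x + t *\<^sub>R sharp \<kappa> n)
      = form \<kappa> x x + 2 * t * (n \<bullet> x) + t * t * form \<kappa> n n"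
    proof -
      have "form \<kappa> (x + t *\<^sub>R y) (x + t *\<^sub>R y)
        = form \<kappa> x x + 2 * t * form \<kappa> x y + t * t * form \<kappa> y y" for y
        by (simp add: form_def algebra_simps)
      moreover have "form \<kappa> x (sharp \<kappa> n) = n \<bullet> x"
        using k by (auto simp: form_def inner_vec_def sum_3 algebra_simps)
      moreover have "form \<kappa> (sharp \<kappa> n) (sharp \<kappa> n) = form \<kappa> n n"
        using k by (auto simp: form_def)
      ultimately show ?thesis by simp
    qed
    ultimately have "t * (t + 2 * (n \<bullet> x)) = 0"
      using n(2) by (simp add: algebra_simps)
    with t show ?thesis by blast
  next
    case True
    have 3: "x$3 = 1" "A$3 = 1" "B$3 = 1" "d$3 = 0"
      using x A B rx True by (auto simp: surface_def d_def)
    have dist: "norm (r x - A) = norm (x - A)" "norm (r x - B) = norm (x - B)"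
    proof -
      have "dist (r x) (r y) = dist x y" if "y \<in> surface \<kappa>" for y
        using iso x that True by (auto simp: isometries_def geo_dist_def)
      from this[OF A] this[OF B] show "norm (r x - A) = norm (x - A)" "norm (r x - B) = norm (x - B)"
        by (simp_all add: rA rB dist_norm)
    qed
    then have sq: "2 * (d \<bullet> (x - A)) + d \<bullet> d = 0" "2 * (d \<bullet> (x - B)) + d \<bullet> d = 0"
      by (simp_all add: norm_eq rxd inner_simps inner_commute)
    then have "d \<bullet> (A - B) = 0" by (simp add: inner_simps)
    then have dAB: "d$1 * A$1 + d$2 * A$2 = d$1 * B$1 + d$2 * B$2"
      using 3 by (simp add: inner_vec_def sum_3 algebra_simps)
    \<comment> \<open>The functional with gradient \<open>d\<close> that vanishes at \<open>A\<close>, and hence at \<open>B\<close>.\<close>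
    define e :: "real^3" where "e = vector [d$1, d$2, - (d$1 * A$1 + d$2 * A$2)]"
    have "e \<bullet> A = 0" "e \<bullet> B = 0"
      using 3 dAB by (simp_all add: e_def inner_vec_def sum_3)
    then obtain t where "e = t *\<^sub>R (A \<times> B)"
      using orthogonal_imp_multiple_cross nz by blast
    then have e: "e = (t / s) *\<^sub>R n" using s by (simp add: n)
    then have "e $ i = (t / s) * n $ i" for i by simp
    from this[of 1] this[of 2] have "d = (t / s) *\<^sub>R sharp \<kappa> n"
      using True 3 by (simp add: vec_eq_iff forall_3 e_def)
    then obtain t where t: "d = t *\<^sub>R sharp \<kappa> n" by blast
    have "d \<bullet> (x - A) = t * (n \<bullet> x)"
    proof -
      have "n \<bullet> x = n \<bullet> (x - A)" using nA by (simp add: inner_simps)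
      also have "\<dots> = sharp \<kappa> n \<bullet> (x - A)" using 3 by (simp add: inner_vec_def sum_3)
      finally show ?thesis by (simp add: t)
    qed
    moreover have "d \<bullet> d = t * t"
    proof -
      have "d \<bullet> d = t * t * form \<kappa> n n"
        using True by (simp add: t inner_vec_def sum_3 form_def algebra_simps)
      then show ?thesis using n by simp
    qed
    ultimately have "t * (t + 2 * (n \<bullet> x)) = 0"
      using sq(1) by (simp add: algebra_simps)
    with t show ?thesis by blast
  qed
  then obtain t where t: "d = t *\<^sub>R sharp \<kappa> n" "t = 0 \<or> t = - 2 * (n \<bullet> x)"
    by (auto simp: eq_neg_iff_add_eq_0)
  show ?thesis
  proof (cases "t = 0")
    case True
    then have "r x = x" using t by (simp add: d_def)
    then have "x \<in> span {A, B}" using fixed x by blast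
    then have "n \<bullet> x = 0"
      using nA nB orthogonal_to_span[of x "{A, B}" n] by (auto simp: orthogonal_def)
    then show ?thesis using \<open>r x = x\<close> by simp
  next
    case False
    then show ?thesis using t by (simp add: rxd)
  qed
qed

section \<open>The chamber of a triangle group\<close>

lemma triple_product_nonzero:
  fixes P Q R :: "real^3"
  assumes "distinct [P, Q, R]" "independent {P, Q, R}"
  shows "(P \<times> Q) \<bullet> R \<noteq> 0"
proof
  assume zero: "(P \<times> Q) \<bullet> R = 0"
  have "((Q \<times> R) \<bullet> x) *\<^sub>R P + ((R \<times> P) \<bullet> x) *\<^sub>R Q + ((P \<times> Q) \<bullet> x) *\<^sub>R R
        = ((P \<times> Q) \<bullet> R) *\<^sub>R x" for x
    by (simp add: cross3_simps forall_3)
  then have comb: "((Q \<times> R) \<bullet> x) *\<^sub>R P + ((R \<times> P) \<bullet> x) *\<^sub>R Q + ((P \<times> Q) \<bullet> x) *\<^sub>R R = 0" for x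
    by (simp add: zero)
  have notin: "P \<notin> span {Q, R}" "R \<notin> span {Q}" "Q \<noteq> 0" "R \<noteq> 0"
  proof -
    have "independent {Q, R}" using assms(2) by (rule independent_mono) auto
    then show "P \<notin> span {Q, R}" "R \<notin> span {Q}" "Q \<noteq> 0" "R \<noteq> 0"
      using assms(1) assms(2) dependent_zero[of "{Q, R}"] span_zero[of "{Q}"]
      by (auto simp: independent_insert insert_commute[of Q R])
  qed
  have "(Q \<times> R) \<bullet> x = 0" for x
  proof (rule ccontr)
    define p where "p = (Q \<times> R) \<bullet> x"
    assume "(Q \<times> R) \<bullet> x \<noteq> 0"
    then have "p \<noteq> 0" by (simp add: p_def)
    have "p *\<^sub>R P = (- ((R \<times> P) \<bullet> x)) *\<^sub>R Q + (- ((P \<times> Q) \<bullet> x)) *\<^sub>R R"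
      using comb[of x, folded p_def] by (simp add: algebra_simps add_eq_0_iff2)
    also have "\<dots> \<in> span {Q, R}"
      by (intro span_add span_scale span_base) auto
    finally have "(1 / p) *\<^sub>R p *\<^sub>R P \<in> span {Q, R}" by (rule span_scale)
    then show False using \<open>p \<noteq> 0\<close> notin by simp
  qed
  then have "Q \<times> R = 0" using inner_eq_zero_iff by blast
  then obtain r where "R = r *\<^sub>R Q"
    using notin by (auto simp: cross_eq_0 collinear_lemma)
  then show False using notin by (metis insertI1 span_base span_scale)
qed

text \<open>The unit normal of the side \<open>A B\<close> that points to the side on which \<open>C\<close> lies.\<close>
definition side_normal :: "real \<Rightarrow> real^3 \<Rightarrow> real^3 \<Rightarrow> real^3 \<Rightarrow> real^3" where
  "side_normal \<kappa> A B C =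
     (sgn ((A \<times> B) \<bullet> C) / sqrt (form \<kappa> (A \<times> B) (A \<times> B))) *\<^sub>R (A \<times> B)"

context
  fixes \<kappa> :: real and A B C :: "real^3"
  assumes \<kappa>: "\<kappa> \<in> {1, 0, -1}"
    and surface: "A \<in> surface \<kappa>" "B \<in> surface \<kappa>" "C \<in> surface \<kappa>"
    and triple: "(A \<times> B) \<bullet> C \<noteq> 0"
begin

lemma cross_AB_nonzero: "A \<times> B \<noteq> 0"
  using triple by auto

lemma form_side_normal_self: "form \<kappa> (side_normal \<kappa> A B C) (side_normal \<kappa> A B C) = 1"
  using form_normal_pos[OF \<kappa> surface(1,2) cross_AB_nonzero] triple
  by (simp add: side_normal_def form_scale sgn_if)

lemma side_normal_inner:
  "side_normal \<kappa> A B C \<bullet> A = 0" "side_normal \<kappa> A B C \<bullet> B = 0" "side_normal \<kappa> A B C \<bullet> C > 0"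
  using form_normal_pos[OF \<kappa> surface(1,2) cross_AB_nonzero] triple
  by (auto simp: side_normal_def dot_cross_self sgn_if field_simps)

text \<open>
  The sign comes from orientation: both normals point into the triangle, so they enclose the
  exterior angle at \<open>A\<close>.
\<close>
lemma form_side_normals:
  "form \<kappa> (side_normal \<kappa> A B C) (side_normal \<kappa> C A B) = - cos (geo_angle \<kappa> A B C)"
proof -
  define u where "u = A \<times> B"
  define v where "v = A \<times> C"
  have CA: "C \<times> A = - v" unfolding v_def by (rule cross_skew)
  have "v \<noteq> 0" "u \<noteq> 0"
    using triple cross_inner_cycle(2)[of A B C] CA by (auto simp: u_def)
  then have uu: "form \<kappa> u u > 0" and vv: "form \<kappa> v v > 0"
    unfolding u_def v_def using form_normal_pos[OF \<kappa>] surface by blast+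
  define y where "y = form \<kappa> u v / (sqrt (form \<kappa> u u) * sqrt (form \<kappa> v v))"
  have angle: "geo_angle \<kappa> A B C = arccos y"
    by (simp add: geo_angle_def Let_def y_def u_def v_def form_cross_cross[OF \<kappa>] surface)
  have "(form \<kappa> u v)\<^sup>2 \<le> form \<kappa> u u * form \<kappa> v v"
    using gram_cross[OF \<kappa> surface(1), of B C, folded u_def v_def] zero_le_power2[of "u \<bullet> C"]
    by linarith
  then have "y\<^sup>2 \<le> 1"
    using uu vv by (simp add: y_def power_divide power_mult_distrib)
  then have "\<bar>y\<bar> \<le> 1" by (simp add: abs_square_le_1)
  then have cos: "cos (geo_angle \<kappa> A B C) = y" by (simp add: angle)
  have "(C \<times> A) \<bullet> B = (A \<times> B) \<bullet> C" by (simp add: cross_inner_cycle(2)[of A B C])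
  then have "form \<kappa> (side_normal \<kappa> A B C) (side_normal \<kappa> C A B)
    = (sgn ((A \<times> B) \<bullet> C))\<^sup>2 * form \<kappa> u (- v) / (sqrt (form \<kappa> u u) * sqrt (form \<kappa> (- v) (- v)))"
    unfolding side_normal_def CA form_scale by (simp add: u_def power2_eq_square)
  also have "\<dots> = - y"
  proof -
    have "form \<kappa> u (- v) = - form \<kappa> u v" "form \<kappa> (- v) (- v) = form \<kappa> v v"
      by (simp_all add: form_def)
    then show ?thesis using triple by (simp add: y_def sgn_if)
  qed
  finally show ?thesis by (simp add: cos)
qed

lemma reflection_in_side:
  assumes "is_reflection \<kappa> (geodesic_line \<kappa> A B) r" "x \<in> surface \<kappa>"
  shows "r x = x - (2 * (side_normal \<kappa> A B C \<bullet> x)) *\<^sub>R sharp \<kappa> (side_normal \<kappa> A B C)"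
  by (rule reflection_formula[OF \<kappa> surface(1,2) cross_AB_nonzero assms side_normal_def
        form_side_normal_self])

end

text \<open>
  Every ray through the inside of the cone over a triangle meets the surface; the ray through the
  sum of the vertices is enough to get an inner point of the triangle.
\<close>
lemma surface_rescale:
  assumes \<kappa>: "\<kappa> \<in> {1, 0, -1}" and "P \<in> surface \<kappa>" "Q \<in> surface \<kappa>" "R \<in> surface \<kappa>"
    and nz: "P + Q + R \<noteq> 0"
  shows "\<exists>\<mu>>0. \<mu> *\<^sub>R (P + Q + R) \<in> surface \<kappa>"
proof -
  from \<kappa> consider "\<kappa> = 1" | "\<kappa> = 0" | "\<kappa> = -1" by auto
  then show ?thesis
  proof cases
    case 1
    then show ?thesis using nz
      by (intro exI[of _ "1 / norm (P + Q + R)"]) (simp add: surface_def)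
  next
    case 2
    then show ?thesis using assms
      by (intro exI[of _ "1 / 3"]) (simp add: surface_def)
  next
    case 3
    define x where "x = P + Q + R"
    have S: "P \<in> surface (-1)" "Q \<in> surface (-1)" "R \<in> surface (-1)" using assms 3 by auto
    have "form (-1) x x = form (-1) P P + form (-1) Q Q + form (-1) R R
        + 2 * form (-1) P Q + 2 * form (-1) Q R + 2 * form (-1) R P"
      by (simp add: form_def x_def algebra_simps)
    moreover have "form (-1) P P = -1" "form (-1) Q Q = -1" "form (-1) R R = -1"
      using S by (auto simp: surface_def)
    ultimately have "form (-1) x x < 0"
      using hyperbolic_form_le(1)[OF S(1,2)] hyperbolic_form_le(1)[OF S(2,3)]
        hyperbolic_form_le(1)[OF S(3,1)] by linarith
    moreover have "x $ 3 > 0" using S by (simp add: x_def surface_def)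
    ultimately have "(1 / sqrt (- form (-1) x x)) *\<^sub>R x \<in> surface \<kappa>"
      "1 / sqrt (- form (-1) x x) > 0"
      using 3 by (simp_all add: surface_def form_scale)
    then show ?thesis unfolding x_def by blast
  qed
qed

text \<open>
  Passing from the group of extensional bijections of \<open>X\<close> to words that act linearly on the whole
  space.
\<close>
lemma generate_reflections_act:
  assumes "reflection_system \<alpha> \<nu> m"
    and reflect: "\<And>h. h \<in> R \<Longrightarrow> \<exists>i. \<forall>x\<in>X. h x = reflection_system.reflect \<alpha> \<nu> i x"
    and R: "R \<subseteq> Bij X" and f: "f \<in> generate (BijGroup X) R"
  shows "\<exists>w. \<forall>x\<in>X. f x = reflection_system.act \<alpha> \<nu> w x"
proof -
  interpret reflection_system \<alpha> \<nu> m by fact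
  interpret B: group "BijGroup X" by (rule group_BijGroup)
  have carr: "carrier (BijGroup X) = Bij X" by (simp add: BijGroup_def)
  show ?thesis
    using f
  proof induction
    case one
    show ?case by (intro exI[of _ "[]"]) (simp add: BijGroup_def)
  next
    case (incl h)
    then obtain i where "\<forall>x\<in>X. h x = reflect i x" using reflect by blast
    then show ?case by (intro exI[of _ "[i]"]) simp
  next
    case (inv h)
    then obtain i where i: "\<forall>x\<in>X. h x = reflect i x" using reflect by blast
    have h: "h \<in> Bij X" using inv R by blast
    have "inv_into X h x = reflect i x" if "x \<in> X" for x
    proof (rule inv_into_f_eq)
      show "inj_on h X" using h by (simp add: Bij_def bij_betw_def)
      show X: "reflect i x \<in> X" using funcset_mem[OF Bij_imp_funcset[OF h] that] i that by simp
      show "h (reflect i x) = x" using i X by simp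
    qed
    then show ?case using inv_BijGroup[OF h] by (intro exI[of _ "[i]"]) simp
  next
    case (eng f g)
    then obtain v w where vw: "\<forall>x\<in>X. f x = act v x" "\<forall>x\<in>X. g x = act w x" by blast
    have fg: "f \<in> Bij X" "g \<in> Bij X"
      using eng.hyps B.generate_incl[of R] R carr by blast+
    have "(f \<otimes>\<^bsub>BijGroup X\<^esub> g) x = act (v @ w) x" if "x \<in> X" for x
    proof -
      have "g x \<in> X" using funcset_mem[OF Bij_imp_funcset[OF fg(2)] that] .
      then show ?thesis using vw that fg by (simp add: BijGroup_def compose_def)
    qed
    then show ?case by blast
  qed
qed

text \<open>The three mirrors of a triangle group, as an index type for \<^locale>\<open>reflection_system\<close>.\<close>
datatype side = QR | RP | PQ

text \<open>
  The triangle is the part of the surface in the closed chamber of the three inward normals, and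
  the angles provide the Coxeter matrix; so the theorem of Tits applies to an inner point of the
  triangle.
\<close>
lemma triangle_point_with_free_orbit:
  assumes pq: "p \<ge> 2" "q \<ge> 2" and \<kappa>: "\<kappa> \<in> {1, 0, -1}"
    and tri: "triangle_vertices \<kappa> P Q R"
    and angles: "geo_angle \<kappa> P Q R = pi / real p" "geo_angle \<kappa> Q R P = pi / real q"
      "geo_angle \<kappa> R P Q = pi / 2"
    and a: "is_reflection \<kappa> (geodesic_line \<kappa> Q R) a"
    and b: "is_reflection \<kappa> (geodesic_line \<kappa> P Q) b"
    and c: "is_reflection \<kappa> (geodesic_line \<kappa> P R) c"
  shows "\<exists>x\<in>geodesic_triangle \<kappa> P Q R. \<forall>f\<in>generate (BijGroup (surface \<kappa>)) {a, b, c}.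
           f x \<in> geodesic_triangle \<kappa> P Q R \<longrightarrow> f = \<one>\<^bsub>BijGroup (surface \<kappa>)\<^esub>"
proof -
  define X where "X = surface \<kappa>"
  have X: "P \<in> surface \<kappa>" "Q \<in> surface \<kappa>" "R \<in> surface \<kappa>"
    and ind: "distinct [P, Q, R]" "independent {P, Q, R}"
    using tri by (auto simp: triangle_vertices_def)
  have D: "(P \<times> Q) \<bullet> R \<noteq> 0" "(Q \<times> R) \<bullet> P \<noteq> 0" "(R \<times> P) \<bullet> Q \<noteq> 0"
    using triple_product_nonzero[OF ind] cross_inner_cycle[of P Q R] by auto
  note PQR = \<kappa> X(1) X(2) X(3) D(1) and QRP = \<kappa> X(2) X(3) X(1) D(2) and RPQ = \<kappa> X(3) X(1) X(2) D(3)
  define n where "n i = (case i of QR \<Rightarrow> side_normal \<kappa> Q R P | RP \<Rightarrow> side_normal \<kappa> R P Q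
    | PQ \<Rightarrow> side_normal \<kappa> P Q R)" for i
  define m where "m i j = (if {i, j} = {QR, PQ} then q else if {i, j} = {RP, PQ} then p else 2)" for i j
  have n_inner: "n QR \<bullet> P > 0" "n QR \<bullet> Q = 0" "n QR \<bullet> R = 0"
    "n RP \<bullet> P = 0" "n RP \<bullet> Q > 0" "n RP \<bullet> R = 0"
    "n PQ \<bullet> P = 0" "n PQ \<bullet> Q = 0" "n PQ \<bullet> R > 0"
    using side_normal_inner[OF PQR] side_normal_inner[OF QRP] side_normal_inner[OF RPQ]
    by (auto simp: n_def)
  have gram: "form \<kappa> (n PQ) (n RP) = - cos (pi / real p)" "form \<kappa> (n QR) (n PQ) = - cos (pi / real q)"
    "form \<kappa> (n RP) (n QR) = - cos (pi / 2)"
    using form_side_normals[OF PQR] form_side_normals[OF QRP] form_side_normals[OF RPQ]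
    by (simp_all only: n_def side.case angles)
  interpret reflection_system "\<lambda>i x. n i \<bullet> x" "\<lambda>i. sharp \<kappa> (n i)" m
  proof (rule reflection_system.intro)
    fix i j :: side
    show "linear ((\<bullet>) (n i))" by (intro linearI) (simp_all add: inner_add_right)
    show "n i \<bullet> sharp \<kappa> (n i) = 1"
      using form_side_normal_self[OF PQR] form_side_normal_self[OF QRP] form_side_normal_self[OF RPQ]
      by (cases i) (auto simp: inner_sharp n_def)
    show "m i j = m j i" by (simp add: m_def insert_commute)
    assume "i \<noteq> j"
    then show "m i j \<ge> 2" using pq by (simp add: m_def)
    show "n i \<bullet> sharp \<kappa> (n j) = - cos (pi / real (m i j))"
      using \<open>i \<noteq> j\<close> gram form_commute[of \<kappa> "n i" "n j"]
      by (cases i; cases j) (simp_all add: inner_sharp m_def doubleton_eq_iff)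
  qed
  have reflect: "\<exists>i. \<forall>x\<in>X. h x = reflect i x" if "h \<in> {a, b, c}" for h
  proof -
    have "geodesic_line \<kappa> P R = geodesic_line \<kappa> R P" by (simp add: geodesic_line_def insert_commute)
    moreover have "side_normal \<kappa> Q R P = n QR" "side_normal \<kappa> P Q R = n PQ" "side_normal \<kappa> R P Q = n RP"
      by (simp_all add: n_def)
    ultimately have "\<forall>x\<in>X. a x = reflect QR x" "\<forall>x\<in>X. b x = reflect PQ x" "\<forall>x\<in>X. c x = reflect RP x"
      using reflection_in_side[OF QRP a] reflection_in_side[OF PQR b] reflection_in_side[OF RPQ, of c] c
      by (simp_all add: reflect_def X_def)
    with that show ?thesis by blast
  qed
  have bij: "{a, b, c} \<subseteq> Bij X"
    using a b c by (auto simp: is_reflection_def isometries_def X_def)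
  have "n QR \<bullet> (P + Q + R) \<noteq> 0" using n_inner by (simp add: inner_add_right)
  then have "P + Q + R \<noteq> 0" by auto
  then obtain \<mu> where \<mu>: "\<mu> > 0" "\<mu> *\<^sub>R (P + Q + R) \<in> surface \<kappa>"
    using surface_rescale[OF \<kappa> X] by blast
  define x where "x = \<mu> *\<^sub>R (P + Q + R)"
  have "x = \<mu> *\<^sub>R P + \<mu> *\<^sub>R Q + \<mu> *\<^sub>R R" by (simp add: x_def scaleR_add_right)
  then have xF: "x \<in> geodesic_triangle \<kappa> P Q R"
    using \<mu> unfolding geodesic_triangle_def x_def by (auto intro!: exI[of _ \<mu>])
  have x_pos: "n i \<bullet> x > 0" for i
    using n_inner \<mu>(1) by (cases i) (simp_all add: x_def inner_add_right)
  have F_nonneg: "n i \<bullet> y \<ge> 0" if "y \<in> geodesic_triangle \<kappa> P Q R" for i y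
    using that n_inner by (cases i) (auto simp: geodesic_triangle_def inner_add_right)
  show ?thesis
  proof (intro bexI[OF _ xF] ballI impI)
    fix f assume f: "f \<in> generate (BijGroup (surface \<kappa>)) {a, b, c}"
      and fx: "f x \<in> geodesic_triangle \<kappa> P Q R"
    obtain w where w: "\<forall>x\<in>X. f x = act w x"
      using generate_reflections_act[OF reflection_system_axioms reflect bij f[folded X_def]] by blast
    have "x \<in> X" using xF by (simp add: geodesic_triangle_def X_def)
    then have "act w y = y" for y
      using F_nonneg[OF fx] w x_pos by (intro chamber_point_leaves_closed_chamber) auto
    moreover have "f \<in> Bij X"
    proof -
      have "carrier (BijGroup X) = Bij X" by (simp add: BijGroup_def)
      then show ?thesis
        using group.generate_incl[OF group_BijGroup, of "{a, b, c}" X] bij f X_def by blast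
    qed
    ultimately show "f = \<one>\<^bsub>BijGroup (surface \<kappa>)\<^esub>"
      using w Bij_imp_extensional[of f X]
      by (auto simp: BijGroup_def X_def[symmetric] intro!: extensionalityI[of _ X])
  qed
qed

section \<open>Colourings by left cosets\<close>

text \<open>
  The point \<open>x\<close> serves as a marker: \<open>f x \<in> g F\<close> only if \<open>f = g\<close>, so a tile \<open>f F\<close> determines \<open>f\<close>,
  and it can be contained in a union of tiles \<open>g F\<close> only if \<open>f\<close> is one of the \<open>g\<close>.
\<close>
lemma induces_perfect_colouring_iff:
  fixes X :: "'a set" and G :: "('a \<Rightarrow> 'a) monoid"
  assumes H: "subgroup H (BijGroup X)" and G: "G = (BijGroup X) \<lparr>carrier := H\<rparr>"
    and F: "F \<subseteq> X" and x: "x \<in> F"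
    and free: "\<And>f. f \<in> H \<Longrightarrow> f x \<in> F \<Longrightarrow> f = \<one>\<^bsub>G\<^esub>"
    and S: "subgroup S G" and fin: "finite (lcosets\<^bsub>G\<^esub> S)" and k: "card (lcosets\<^bsub>G\<^esub> S) = k"
    and R: "R \<subseteq> H"
  shows "induces_perfect_colouring G F S k (orbit_tiling G F R) \<longleftrightarrow> R \<subseteq> S"
proof -
  interpret B: group "BijGroup X" by (rule group_BijGroup)
  interpret G: group G unfolding G by (rule B.subgroup_imp_group[OF H])
  interpret S: subgroup S G by (rule S)
  have carr: "carrier G = H" by (simp add: G)
  have HB: "f \<in> Bij X" if "f \<in> H" for f
    using subgroup.subset[OF H] that by (auto simp: BijGroup_def)
  have mult: "f \<otimes>\<^bsub>G\<^esub> g = compose X f g" if "f \<in> H" "g \<in> H" for f g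
    using HB that by (simp add: G BijGroup_def)
  have img: "(f \<otimes>\<^bsub>G\<^esub> g) ` A = f ` g ` A" if "f \<in> H" "g \<in> H" "A \<subseteq> X" for f g A
    using that by (auto simp: mult compose_def image_image subset_iff intro!: image_cong)
  have one: "\<one>\<^bsub>G\<^esub> ` A = A" if "A \<subseteq> X" for A
    using that by (auto simp: G BijGroup_def subset_iff image_iff)
  have subX: "f ` A \<subseteq> X" if "f \<in> H" "A \<subseteq> X" for f A
    using Bij_imp_funcset[OF HB[OF that(1)]] that(2) by auto
  have eqI: "f = g" if f: "f \<in> H" and g: "g \<in> H" and *: "f x \<in> g ` F" for f g
  proof -
    have "f ` {x} \<subseteq> g ` F" using * by simp
    then have "(inv\<^bsub>G\<^esub> g) ` f ` {x} \<subseteq> (inv\<^bsub>G\<^esub> g) ` g ` F" by blast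
    then have "(inv\<^bsub>G\<^esub> g \<otimes>\<^bsub>G\<^esub> f) ` {x} \<subseteq> (inv\<^bsub>G\<^esub> g \<otimes>\<^bsub>G\<^esub> g) ` F"
      using f g F x carr by (subst (1 2) img) auto
    then have "(inv\<^bsub>G\<^esub> g \<otimes>\<^bsub>G\<^esub> f) x \<in> F"
      using g F one by (simp add: carr)
    then have "inv\<^bsub>G\<^esub> g \<otimes>\<^bsub>G\<^esub> f = \<one>\<^bsub>G\<^esub>"
      using f g G.inv_closed[of g] G.m_closed[of "inv\<^bsub>G\<^esub> g" f] by (intro free) (simp_all add: carr)
    then have "f = g \<otimes>\<^bsub>G\<^esub> \<one>\<^bsub>G\<^esub>"
      using f g G.inv_solve_left'[of "\<one>\<^bsub>G\<^esub>" g f] G.one_closed by (simp add: carr)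
    then show ?thesis using g by (simp add: carr)
  qed
  have S_coset: "S \<in> lcosets\<^bsub>G\<^esub> S"
    using G.lcos_self[OF G.one_closed S] G.one_closed S.subset
    by (auto simp: LCOSETS_def l_coset_def intro!: bexI[of _ "\<one>\<^bsub>G\<^esub>"])
  have coset_eq: "f <#\<^bsub>G\<^esub> S = A" if "A \<in> lcosets\<^bsub>G\<^esub> S" "f \<in> A" for f A
    using that G.l_repr_independence[OF _ _ S] by (auto simp: LCOSETS_def)
  have mem_coset: "f \<in> f <#\<^bsub>G\<^esub> S" "f <#\<^bsub>G\<^esub> S \<in> lcosets\<^bsub>G\<^esub> S" if "f \<in> H" for f
    using that G.lcos_self[OF _ S] by (auto simp: LCOSETS_def carr)
  have coset_sub: "A \<subseteq> H" if "A \<in> lcosets\<^bsub>G\<^esub> S" for A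
    using S.lcosets_carrier[OF G.is_group that] carr by simp
  define K where "K = generate G R"
  define Y where "Y = (\<Union>h\<in>K. h ` F)"
  have K: "K \<subseteq> H" using G.generate_incl[of R] R by (simp add: K_def carr)
  have one_K: "\<one>\<^bsub>G\<^esub> \<in> K" by (simp add: K_def generate.one)
  have YX: "Y \<subseteq> X" using K subX F unfolding Y_def by blast
  have tiling: "orbit_tiling G F R = {g ` Y | g. g \<in> H}"
    by (simp add: orbit_tiling_def K_def Y_def carr)
  show ?thesis
  proof
    assume "induces_perfect_colouring G F S k (orbit_tiling G F R)"
    then obtain c d where "left_coset_colouring G F S k c"
      and d: "\<forall>y\<in>orbit_tiling G F R. \<forall>t\<in>triangle_tiling G F. t \<subseteq> y \<longrightarrow> d y = c t"
      unfolding induces_perfect_colouring_def by auto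
    then obtain C where C: "C ` {1..k} = lcosets\<^bsub>G\<^esub> S" "C 1 = S"
      and c: "\<forall>i\<in>{1..k}. \<forall>f\<in>C i. c (f ` F) = i"
      unfolding left_coset_colouring_def bij_betw_def by auto
    have "k \<noteq> 0" using S_coset fin k card_0_eq by (metis empty_iff)
    have Y: "Y \<in> orbit_tiling G F R"
      unfolding tiling using one[OF YX] G.one_closed carr by auto
    have d_eq: "d Y = c (h ` F)" if "h \<in> K" for h
      using that K by (intro d[rule_format] Y) (auto simp: triangle_tiling_def carr Y_def)
    show "R \<subseteq> S"
    proof
      fix r assume r: "r \<in> R"
      then have rK: "r \<in> K" by (simp add: K_def generate.incl)
      then obtain i where i: "i \<in> {1..k}" "r \<in> C i"
        using C(1) mem_coset[of r] K by (metis imageE subsetD)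
      have "i = c (r ` F)" using c i by simp
      also have "\<dots> = c (\<one>\<^bsub>G\<^esub> ` F)" using d_eq rK one_K by metis
      also have "\<dots> = 1" using C(2) \<open>k \<noteq> 0\<close> by (intro c[rule_format]) auto
      finally show "r \<in> S" using i C(2) by simp
    qed
  next
    assume RS: "R \<subseteq> S"
    have KS: "K \<subseteq> S" unfolding K_def by (rule G.generate_subgroup_incl[OF RS S])
    \<comment> \<open>A numbering of the cosets in which \<open>S\<close> comes first.\<close>
    obtain C0 where C0: "bij_betw C0 {1..k} (lcosets\<^bsub>G\<^esub> S)"
      using ex_bij_betw_nat_finite_1[OF fin] k by auto
    obtain j where j: "j \<in> {1..k}" "C0 j = S"
      using C0 S_coset by (metis bij_betw_imp_surj_on imageE)
    define C where "C = C0 \<circ> Transposition.transpose 1 j"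
    have C: "bij_betw C {1..k} (lcosets\<^bsub>G\<^esub> S)"
      unfolding C_def using j
      by (intro bij_betw_trans[OF _ C0] permutes_imp_bij permutes_swap_id) auto
    have C1: "C 1 = S" by (simp add: C_def j)
    have Cinj: "i = i'" if "i \<in> {1..k}" "i' \<in> {1..k}" "C i = C i'" for i i'
      using inj_onD[OF bij_betw_imp_inj_on[OF C] that(3,1,2)] .
    define num where "num f = inv_into {1..k} C (f <#\<^bsub>G\<^esub> S)" for f
    have num: "num f \<in> {1..k}" "C (num f) = f <#\<^bsub>G\<^esub> S" if "f \<in> H" for f
    proof -
      have "f <#\<^bsub>G\<^esub> S \<in> C ` {1..k}"
        using mem_coset(2)[OF that] bij_betw_imp_surj_on[OF C] by simp
      then show "num f \<in> {1..k}" "C (num f) = f <#\<^bsub>G\<^esub> S"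
        unfolding num_def by (rule inv_into_into, rule f_inv_into_f)
    qed
    have num_eq: "num f = i" if "i \<in> {1..k}" "f \<in> C i" for i f
    proof -
      have Ci: "C i \<in> lcosets\<^bsub>G\<^esub> S" by (rule bij_betw_apply[OF C that(1)])
      then have "f \<in> H" using coset_sub that by blast
      with num[of f] coset_eq[OF Ci that(2)] that(1) show ?thesis by (intro Cinj) simp_all
    qed
    have num_mult: "num (f \<otimes>\<^bsub>G\<^esub> s) = num f" if "f \<in> H" "s \<in> S" for f s
    proof -
      have "f \<otimes>\<^bsub>G\<^esub> s \<in> f <#\<^bsub>G\<^esub> S" using that by (auto simp: l_coset_def)
      then show ?thesis using num[OF that(1)] by (intro num_eq) auto
    qed
    define c where "c t = num (THE f. f \<in> H \<and> f ` F = t)" for t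
    define d where "d y = num (SOME g. g \<in> H \<and> g ` Y = y)" for y
    have c: "c (f ` F) = num f" if "f \<in> H" for f
    proof -
      have "(THE g. g \<in> H \<and> g ` F = f ` F) = f"
        using that x by (intro the_equality) (auto intro!: eqI)
      then show ?thesis by (simp add: c_def)
    qed
    have same_num: "num f = num g" if "f \<in> H" "g \<in> H" "f ` F \<subseteq> g ` Y" for f g
    proof -
      from that x have "f x \<in> g ` Y" by blast
      then obtain h where h: "h \<in> K" "f x \<in> g ` h ` F" by (auto simp: Y_def)
      then have "f x \<in> (g \<otimes>\<^bsub>G\<^esub> h) ` F" using img that F K by auto
      then have "f = g \<otimes>\<^bsub>G\<^esub> h"
        using that h K G.m_closed[of g h] carr by (intro eqI) auto
      then show ?thesis using num_mult that h KS by auto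
    qed
    have FY: "F \<subseteq> Y" using one[OF F] one_K by (auto simp: Y_def)
    have d: "d (g ` Y) = num g" if "g \<in> H" for g
    proof -
      have "(SOME g'. g' \<in> H \<and> g' ` Y = g ` Y) \<in> H \<and> (SOME g'. g' \<in> H \<and> g' ` Y = g ` Y) ` Y = g ` Y"
        using that by (intro someI[of "\<lambda>g'. g' \<in> H \<and> g' ` Y = g ` Y"]) auto
      then show ?thesis
        unfolding d_def using that FY by (intro same_num) blast+
    qed
    have num_surj: "num ` H = {1..k}"
    proof safe
      fix i assume i: "i \<in> {1..k}"
      then have Ci: "C i \<in> lcosets\<^bsub>G\<^esub> S" by (rule bij_betw_apply[OF C])
      then obtain f where "f \<in> C i" using mem_coset(1) unfolding LCOSETS_def carr by blast
      then show "i \<in> num ` H" using num_eq[OF i] coset_sub[OF Ci] by force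
    qed (use num(1) in auto)
    have "left_coset_colouring G F S k c"
      unfolding left_coset_colouring_def colouring_def
    proof (intro conjI exI[of _ C] ballI)
      have "c ` triangle_tiling G F = num ` H"
        by (force simp: triangle_tiling_def carr c)
      then show "c ` triangle_tiling G F = {1..k}" by (simp add: num_surj)
      show "c (f ` F) = i" if "i \<in> {1..k}" "f \<in> C i" for i f
        using that num_eq c coset_sub C by (metis bij_betw_apply subsetD)
    qed (use C C1 in auto)
    moreover have "d y = c t" if "y \<in> orbit_tiling G F R" "t \<in> triangle_tiling G F" "t \<subseteq> y" for y t
      using that same_num by (auto simp: tiling triangle_tiling_def carr c d)
    moreover have "perfect_colouring G k (orbit_tiling G F R) d"
      unfolding perfect_colouring_def colouring_def
    proof (intro conjI ballI)
      have "d ` orbit_tiling G F R = num ` H"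
        by (force simp: tiling d)
      then show "d ` orbit_tiling G F R = {1..k}" by (simp add: num_surj)
    next
      fix h assume "h \<in> carrier G"
      then have h: "h \<in> H" by (simp add: carr)
      \<comment> \<open>Left multiplication by \<open>h\<close>, transported to the numbers of the cosets.\<close>
      define \<pi> where "\<pi> i = (if i \<in> {1..k} then num (h \<otimes>\<^bsub>G\<^esub> (SOME f. f \<in> H \<and> num f = i)) else i)" for i
      have num_cong: "num (g \<otimes>\<^bsub>G\<^esub> f) = num (g \<otimes>\<^bsub>G\<^esub> f')"
        if "f \<in> H" "f' \<in> H" "g \<in> H" "num f = num f'" for f f' g
      proof -
        have "f \<in> f' <#\<^bsub>G\<^esub> S" using num(2) mem_coset(1) that by metis
        then obtain s where "s \<in> S" "f = f' \<otimes>\<^bsub>G\<^esub> s" by (auto simp: l_coset_def)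
        then show ?thesis
          using that num_mult[of "g \<otimes>\<^bsub>G\<^esub> f'" s] G.m_assoc[of g f' s] G.m_closed[of g f'] carr by auto
      qed
      have \<pi>: "\<pi> (num f) = num (h \<otimes>\<^bsub>G\<^esub> f)" if "f \<in> H" for f
      proof -
        define g where "g = (SOME g. g \<in> H \<and> num g = num f)"
        have "g \<in> H \<and> num g = num f"
          unfolding g_def by (rule someI[of "\<lambda>g. g \<in> H \<and> num g = num f" f]) (simp add: that)
        then have "num (h \<otimes>\<^bsub>G\<^esub> g) = num (h \<otimes>\<^bsub>G\<^esub> f)"
          using that h by (intro num_cong) simp_all
        then show ?thesis using num(1)[OF that] by (simp only: \<pi>_def g_def if_True)
      qed
      have "\<pi> ` {1..k} = {1..k}"
      proof -
        have "\<pi> ` {1..k} = (\<lambda>f. num (h \<otimes>\<^bsub>G\<^esub> f)) ` H"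
          unfolding num_surj[symmetric] image_image using \<pi> by auto
        also have "\<dots> = num ` (\<lambda>f. h \<otimes>\<^bsub>G\<^esub> f) ` H" by (simp add: image_image)
        also have "(\<lambda>f. h \<otimes>\<^bsub>G\<^esub> f) ` H = H"
          using G.surj_const_mult[of h] h carr by simp
        finally show ?thesis by (simp add: num_surj)
      qed
      then have "\<pi> permutes {1..k}"
        by (intro bij_imp_permutes) (auto simp: bij_betw_def eq_card_imp_inj_on \<pi>_def)
      moreover have "d (h ` y) = \<pi> (d y)" if y: "y \<in> orbit_tiling G F R" for y
      proof -
        obtain g where g: "g \<in> H" "y = g ` Y" using y tiling by auto
        then have "h ` y = (h \<otimes>\<^bsub>G\<^esub> g) ` Y" using img h YX by simp
        then show ?thesis
          using g h \<pi> d G.m_closed[of h g] carr by simp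
      qed
      ultimately show "\<exists>\<pi>. \<pi> permutes {1..k} \<and> (\<forall>x\<in>orbit_tiling G F R. d (h ` x) = \<pi> (d x))"
        by blast
    qed
    ultimately show "induces_perfect_colouring G F S k (orbit_tiling G F R)"
      unfolding induces_perfect_colouring_def by blast
  qed
qed

theorem lemma3p2:
  fixes p q k :: nat
    and \<kappa> :: real
    and P Q R :: "real^3"
    and F :: "(real^3) set"
    and a b c :: "real^3 \<Rightarrow> real^3"
    and G :: "(real^3 \<Rightarrow> real^3) monoid"
    and S :: "(real^3 \<Rightarrow> real^3) set"
  assumes "p \<ge> 3" and "q \<ge> 3"
    and "\<kappa> = curvature p q"
    and "triangle_vertices \<kappa> P Q R"
    and "geo_angle \<kappa> P Q R = pi / real p"
    and "geo_angle \<kappa> Q R P = pi / real q"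
    and "geo_angle \<kappa> R P Q = pi / 2"
    and "F = geodesic_triangle \<kappa> P Q R"
    and "is_reflection \<kappa> (geodesic_line \<kappa> Q R) a"
    and "is_reflection \<kappa> (geodesic_line \<kappa> P Q) b"
    and "is_reflection \<kappa> (geodesic_line \<kappa> P R) c"
    and "G = reflection_group \<kappa> {a, b, c}"
    and "subgroup S G"
    and "finite (lcosets\<^bsub>G\<^esub> S)" and "card (lcosets\<^bsub>G\<^esub> S) = k"
  shows "(induces_perfect_colouring G F S k (orbit_tiling G F {a, b}) \<longleftrightarrow> a \<in> S \<and> b \<in> S) \<and>
         (induces_perfect_colouring G F S k (orbit_tiling G F {b, c}) \<longleftrightarrow> b \<in> S \<and> c \<in> S) \<and>
         (induces_perfect_colouring G F S k (orbit_tiling G F {a, c}) \<longleftrightarrow> a \<in> S \<and> c \<in> S)"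
proof -
  have \<kappa>: "\<kappa> \<in> {1, 0, -1}"
    using assms(3) by (auto simp: curvature_def sgn_if)
  define H where "H = generate (BijGroup (surface \<kappa>)) {a, b, c}"
  have G: "G = (BijGroup (surface \<kappa>)) \<lparr>carrier := H\<rparr>"
    using assms(12) by (simp add: reflection_group_def H_def)
  have "{a, b, c} \<subseteq> carrier (BijGroup (surface \<kappa>))"
    using assms(9-11) by (auto simp: is_reflection_def isometries_def BijGroup_def)
  then have H: "subgroup H (BijGroup (surface \<kappa>))"
    unfolding H_def by (rule group.generate_is_subgroup[OF group_BijGroup])
  have abc: "a \<in> H" "b \<in> H" "c \<in> H" by (simp_all add: H_def generate.incl)
  have F: "F \<subseteq> surface \<kappa>" using assms(8) by (auto simp: geodesic_triangle_def)
  obtain x where x: "x \<in> F" "\<And>f. f \<in> H \<Longrightarrow> f x \<in> F \<Longrightarrow> f = \<one>\<^bsub>G\<^esub>"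
    using triangle_point_with_free_orbit[OF _ _ \<kappa> assms(4-7) assms(9-11)] assms(1,2)
    by (auto simp: H_def G assms(8))
  have "induces_perfect_colouring G F S k (orbit_tiling G F R) \<longleftrightarrow> R \<subseteq> S" if "R \<subseteq> H" for R
    using induces_perfect_colouring_iff[OF H G F x(1) x(2) assms(13-15) that] by simp
  from this[of "{a, b}"] this[of "{b, c}"] this[of "{a, c}"] show ?thesis
    using abc by simp
qed

end
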